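(* Let $\overline{\rho}\in L^1(\mathbb{R})\cap L^\infty(\mathbb{R})$ be non-negative with compact support and $\|\overline{\rho}\|_{L^1(\mathbb{R})}=1$. Let $v(\rho)=v_{\max}-\rho^\gamma$ with $\gamma>0$ and $v_{\max}\in\mathbb{R}$, and let $f(\rho)=\rho v(\rho)$. Let $x_0(t)<\dots<x_n(t)$ be the particles of the follow-the-leader scheme associated with $\overline{\rho}$ and $v$, with discrete densities $R_0(t),\dots,R_{n-1}(t)$ and the convention $R_n(t):=0$. Then, for all $t\ge0$, all $n\in\mathbb{N}$ ($n\geq 1$) and all $i\in\{0,\dots,n-1\}$, $$t\,\frac{v(R_{i+1}(t))-v(R_i(t))}{x_{i+1}(t)-x_i(t)}\le\frac{1}{\gamma+1},$$ which also reads $$t\,\frac{f'(R_{i+1}(t))-f'(R_i(t))}{x_{i+1}(t)-x_i(t)}\le 1.$$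
   Context: Follow-the-leader scheme. Let $[\overline{x}_{\min},\overline{x}_{\max}]$ be the convex hull of $\mathrm{supp}(\overline{\rho})$, $\ell_n:=1/n$, and note $v_{\max}=v(0)$. Set $\overline{x}_0:=\overline{x}_{\min}$, $\overline{x}_n:=\overline{x}_{\max}$ and recursively $\overline{x}_i:=\sup\{x\in\mathbb{R}:\int_{\overline{x}_{i-1}}^x\overline{\rho}(y)\,dy<\ell_n\}$ for $i\in\{1,\dots,n-1\}$. The particles $x_0(t),\dots,x_n(t)$ (depending on $n$) solve $$\dot{x}_i(t)=v(R_i(t)),\ i\in\{0,\dots,n-1\},\qquad \dot{x}_n(t)=v_{\max},\qquad x_i(0)=\overline{x}_i,\ i\in\{0,\dots,n\},$$ where $R_i(t):=\frac{\ell_n}{x_{i+1}(t)-x_i(t)}$ for $i\in\{0,\dots,n-1\}$. It is known (discrete maximum principle) that the particles never collide, $0<R_i(t)\le\|\overline{\rho}\|_{L^\infty(\mathbb{R})}$, and the solution exists for all $t\ge0$. Here $f'(\rho)=v_{\max}-(\gamma+1)\rho^\gamma$. *)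

theory Defs
  imports "HOL-Analysis.Analysis"
begin

(* Support of an element of L^1, i.e. of a function considered up to null sets:
   the complement of the largest open set on which it vanishes almost everywhere. *)
definition ess_support :: "(real \<Rightarrow> real) \<Rightarrow> real set" where
  "ess_support \<rho> = - \<Union>{U. open U \<and> (AE y in lebesgue. y \<in> U \<longrightarrow> \<rho> y = 0)}"

(* Initial positions x_0, ..., x_n; values at indices above n are irrelevant.
   The integral is oriented, so points left of the previous particle belong to the set. *)
primrec ftl_init :: "(real \<Rightarrow> real) \<Rightarrow> nat \<Rightarrow> nat \<Rightarrow> real" where
  "ftl_init \<rho> n 0 = Inf (convex hull (ess_support \<rho>))"
| "ftl_init \<rho> n (Suc i) =
     (if Suc i = n then Sup (convex hull (ess_support \<rho>))
      else Sup {x. (LINT y=ereal (ftl_init \<rho> n i)..ereal x|lebesgue. \<rho> y) < 1 / real n})"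

definition ftl_density :: "nat \<Rightarrow> (nat \<Rightarrow> real \<Rightarrow> real) \<Rightarrow> nat \<Rightarrow> real \<Rightarrow> real" where
  "ftl_density n x i t =
     (if i < n then (1 / real n) / (x (Suc i) t - x i t) else 0)"

(* The phase space of the system is the set of strictly ordered configurations,
   so a global solution stays strictly ordered. At t = 0 the derivative is one-sided.
   The speed of the leader is v_max = v 0. *)
definition ftl_particles ::
  "(real \<Rightarrow> real) \<Rightarrow> (real \<Rightarrow> real) \<Rightarrow> nat \<Rightarrow> (nat \<Rightarrow> real \<Rightarrow> real) \<Rightarrow> bool" where
  "ftl_particles \<rho> v n x \<longleftrightarrow>
     (\<forall>i\<le>n. x i 0 = ftl_init \<rho> n i) \<and>
     (\<forall>t\<ge>0. \<forall>i<n. x i t < x (Suc i) t) \<and>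
     (\<forall>t\<ge>0. \<forall>i<n.
        (x i has_real_derivative v (ftl_density n x i t)) (at t within {0..})) \<and>
     (\<forall>t\<ge>0. (x n has_real_derivative v 0) (at t within {0..}))"

(* Derivative of a function of the density, which ranges over [0, \<infinity>);
   it is the right derivative at 0. *)
definition density_deriv :: "(real \<Rightarrow> real) \<Rightarrow> real \<Rightarrow> real" where
  "density_deriv f r = vector_derivative f (at r within {0..})"

end

theory Submission
  imports Defs
begin

text \<open>
  Let \<open>u\<^sub>i = (v(R\<^sub>i\<^sub>+\<^sub>1) - v(R\<^sub>i)) / (x\<^sub>i\<^sub>+\<^sub>1 - x\<^sub>i) = n R\<^sub>i (R\<^sub>i\<^sup>\<gamma> - R\<^sub>i\<^sub>+\<^sub>1\<^sup>\<gamma>)\<close>, so that \<open>R\<^sub>i' = - R\<^sub>i u\<^sub>i\<close>, and let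
  \<open>z\<^sub>i = t u\<^sub>i\<close>, \<open>c = 1 / (\<gamma> + 1)\<close>. Descending from the leader, where \<open>z\<^sub>n = 0\<close>, the bound
  \<open>z\<^sub>i\<^sub>+\<^sub>1 \<le> c\<close> gives \<open>t z\<^sub>i' \<le> (z\<^sub>i + \<gamma> n t R\<^sub>i\<^sup>\<gamma>\<^sup>+\<^sup>1) (c - z\<^sub>i)\<close>, so \<open>z\<^sub>i\<close>, which starts from \<open>0\<close>,
  cannot cross the level \<open>c\<close>.
\<close>

text \<open>After the last time \<open>m\<close> at which \<open>w\<close> is at most
  \<open>c\<close>, the function lies above \<open>c\<close>, hence cannot increase, and so never
  gets above \<open>w m\<close>. The derivative is controlled only at positive times and strictly
  above the level, which is all that the differential inequality for \<open>t * u t\<close>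
  provides.\<close>

lemma stays_below_level:
  fixes w :: "real \<Rightarrow> real"
  assumes cont: "continuous_on {0..} w" and "w 0 \<le> c" and "0 \<le> t"
    and deriv: "\<And>s. 0 < s \<Longrightarrow> c < w s \<Longrightarrow> \<exists>d\<le>0. (w has_real_derivative d) (at s)"
  shows "w t \<le> c"
proof (rule ccontr)
  assume "\<not> w t \<le> c"
  then have wt: "c < w t" by simp
  define S where "S = {s \<in> {0..t}. w s \<le> c}"
  have cont': "continuous_on {0..t} w"
    using cont by (rule continuous_on_subset) auto
  have "closed S"
    using continuous_closed_preimage[OF cont', of "{..c}"]
    by (simp add: S_def Int_def vimage_def)
  moreover have "bounded S" by (rule bounded_subset[of "{0..t}"]) (auto simp: S_def)
  ultimately have "compact S" by (simp add: compact_eq_bounded_closed)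
  moreover have "0 \<in> S" using assms(2,3) by (simp add: S_def)
  \<comment> \<open>Compactness of \<open>S\<close> ensures that a last such time is
    attained.\<close>
  ultimately obtain m where m: "m \<in> S" and max: "\<And>s. s \<in> S \<Longrightarrow> s \<le> m"
    using compact_attains_sup[of S] by auto
  have "0 \<le> m" "m \<le> t" "w m \<le> c" using m by (auto simp: S_def)
  with wt have "m < t" by (cases "m = t") auto
  have above: "c < w s" if "m < s" "s \<le> t" for s
    using that max[of s] \<open>0 \<le> m\<close> by (force simp: S_def)
  have "w differentiable (at s)" if "m < s" "s < t" for s
    using deriv[of s] above[of s] that \<open>0 \<le> m\<close> real_differentiable_def by force
  moreover have "continuous_on {m..t} w"
    using cont' by (rule continuous_on_subset) (use \<open>0 \<le> m\<close> in auto)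
  ultimately obtain l z where z: "m < z" "z < t" "(w has_real_derivative l) (at z)"
      "w t - w m = (t - m) * l"
    using MVT[OF \<open>m < t\<close>, of w] by metis
  obtain d where "d \<le> 0" "(w has_real_derivative d) (at z)"
    using deriv[of z] above[of z] z \<open>0 \<le> m\<close> by auto
  with z(3) have "l \<le> 0" using DERIV_unique by blast
  with z(4) \<open>m < t\<close> have "w t \<le> w m"
    by (smt (verit) mult_nonneg_nonpos)
  with wt \<open>w m \<le> c\<close> show False by simp
qed

lemma DERIV_powr_relative_rate:
  fixes a :: "real \<Rightarrow> real"
  assumes "(a has_real_derivative - a t * u) (at t within S)" and "0 < a t"
  shows "((\<lambda>t. a t powr \<gamma>) has_real_derivative - \<gamma> * a t powr \<gamma> * u) (at t within S)"
  using DERIV_chain2[OF has_real_derivative_powr[OF assms(2), of \<gamma>] assms(1)] assms(2)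
  by (simp add: powr_diff mult_ac)

lemma slope_bound_step:
  fixes a q s :: "real \<Rightarrow> real" and \<gamma> K :: real
  defines "u \<equiv> \<lambda>t. K * a t * (a t powr \<gamma> - q t)"
  assumes "0 < \<gamma>" "0 \<le> K" "0 \<le> t"
    and apos: "\<And>t. 0 \<le> t \<Longrightarrow> 0 < a t"
    and qpos: "\<And>t. 0 \<le> t \<Longrightarrow> 0 \<le> q t"
    and da: "\<And>t. 0 \<le> t \<Longrightarrow> (a has_real_derivative - a t * u t) (at t within {0..})"
    and dq: "\<And>t. 0 \<le> t \<Longrightarrow> (q has_real_derivative - \<gamma> * q t * s t) (at t within {0..})"
    and sb: "\<And>t. 0 \<le> t \<Longrightarrow> t * s t \<le> 1 / (\<gamma> + 1)"
  shows "t * u t \<le> 1 / (\<gamma> + 1)"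
proof (rule stays_below_level[where w = "\<lambda>t. t * u t"])
  define c where "c = 1 / (\<gamma> + 1)"
  \<comment> \<open>This identity singles out the constant: it turns
    \<open>z - z^2 - \<gamma> * c * z\<close> into \<open>z * (c - z)\<close> for
    \<open>z = t * u t\<close>.\<close>
  have gc: "\<gamma> * c = 1 - c" and "0 < c" using \<open>0 < \<gamma>\<close> by (auto simp: c_def field_simps)
  define z' where "z' t = u t + t * (K * a t * \<gamma> * (q t * s t - a t powr \<gamma> * u t) - (u t)\<^sup>2)" for t
  have dp: "((\<lambda>t. a t powr \<gamma>) has_real_derivative - \<gamma> * a t powr \<gamma> * u t) (at t within {0..})"
    if "0 \<le> t" for t
    using DERIV_powr_relative_rate[OF da[OF that] apos[OF that]] .
  have dz: "((\<lambda>t. t * u t) has_real_derivative z' t) (at t within {0..})" if "0 \<le> t" for t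
    unfolding u_def
    by (rule derivative_eq_intros da dp dq refl that)+
      (simp add: z'_def u_def algebra_simps power2_eq_square)
  show "continuous_on {0..} (\<lambda>t. t * u t)"
    using dz by (meson DERIV_continuous atLeast_iff continuous_on_eq_continuous_within)
  fix t :: real
  assume "0 < t" and "1 / (\<gamma> + 1) < t * u t"
  then have zc: "c < t * u t" by (simp add: c_def)
  \<comment> \<open>After multiplication by \<open>t\<close>, the next slope occurs only as
    \<open>t * s t\<close>, which \<open>sb\<close> bounds.\<close>
  have "t * z' t = t * u t - (t * u t)\<^sup>2
      + K * a t * \<gamma> * t * (q t * (t * s t) - a t powr \<gamma> * (t * u t))"
    by (simp add: z'_def algebra_simps power2_eq_square)
  also have "\<dots> \<le> t * u t - (t * u t)\<^sup>2 + K * a t * \<gamma> * t * (q t * c - a t powr \<gamma> * (t * u t))"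
    using \<open>0 < t\<close> \<open>0 < \<gamma>\<close> \<open>0 \<le> K\<close> apos[of t] qpos[of t] sb[of t]
    by (intro add_left_mono mult_left_mono diff_right_mono) (auto simp: c_def)
  \<comment> \<open>Here \<open>q\<close> is eliminated through
    \<open>K * a t * q t = K * a t * a t powr \<gamma> - u t\<close>.\<close>
  also have "\<dots> = t * u t - (t * u t)\<^sup>2 - \<gamma> * c * (t * u t)
      + \<gamma> * (K * t * a t * a t powr \<gamma>) * (c - t * u t)"
    by (simp add: u_def algebra_simps power2_eq_square)
  also have "\<dots> = (t * u t + \<gamma> * (K * t * a t * a t powr \<gamma>)) * (c - t * u t)"
    unfolding gc by (simp add: algebra_simps power2_eq_square)
  also have "\<dots> \<le> 0"
    using zc \<open>0 < c\<close> \<open>0 < t\<close> \<open>0 < \<gamma>\<close> \<open>0 \<le> K\<close> apos[of t]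
    by (intro mult_nonneg_nonpos add_nonneg_nonneg) auto
  finally have "z' t \<le> 0" using \<open>0 < t\<close> by (simp add: mult_le_0_iff)
  moreover have "((\<lambda>t. t * u t) has_real_derivative z' t) (at t)"
    using dz[of t] \<open>0 < t\<close> at_within_interior[of t "{0..}"] by simp
  ultimately show "\<exists>d\<le>0. ((\<lambda>t. t * u t) has_real_derivative d) (at t)" by blast
qed (use \<open>0 < \<gamma>\<close> \<open>0 \<le> t\<close> in auto)

text \<open>The point \<open>r = 0\<close> matters because it is the density attached to the leader.
  There the power need not be differentiable, but the difference quotient of the flux is
  \<open>v_max - y powr \<gamma>\<close>, which tends to \<open>v_max\<close>.\<close>

lemma density_deriv_power_flux:
  assumes "0 < \<gamma>" and "0 \<le> r"
    and f: "\<And>r. r \<ge> 0 \<Longrightarrow> f r = r * (v_max - r powr \<gamma>)"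
  shows "density_deriv f r = v_max - (\<gamma> + 1) * r powr \<gamma>"
proof -
  define g where "g r = r * (v_max - r powr \<gamma>)" for r :: real
  have "(g has_real_derivative v_max - (\<gamma> + 1) * r powr \<gamma>) (at r within {0..})"
  proof (cases "r = 0")
    case True
    have "((\<lambda>y. v_max - y powr \<gamma>) \<longlongrightarrow> v_max - 0) (at 0 within {0..})"
      using \<open>0 < \<gamma>\<close>
      by (intro tendsto_diff tendsto_const tendsto_zero_powrI[where b = \<gamma>])
        (auto simp: eventually_at_filter)
    then have "((\<lambda>y. (g y - g 0) / (y - 0)) \<longlongrightarrow> v_max - 0) (at 0 within {0..})"
      by (rule Lim_transform_eventually) (auto simp: g_def eventually_at_filter)
    then show ?thesis using True by (simp add: has_field_derivative_iff)
  next
    case False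
    with \<open>0 \<le> r\<close> have "0 < r" by simp
    show ?thesis
      unfolding g_def
      by (rule derivative_eq_intros refl \<open>0 < r\<close>)+
        (use \<open>0 < r\<close> in \<open>simp add: field_simps powr_diff\<close>)
  qed
  then have "(f has_real_derivative v_max - (\<gamma> + 1) * r powr \<gamma>) (at r within {0..})"
    by (rule has_field_derivative_transform_within[where d = 1])
      (use f \<open>0 \<le> r\<close> in \<open>auto simp: g_def\<close>)
  \<comment> \<open>Nontriviality of the filter makes the derivative unique, so that
    \<open>vector_derivative\<close>, defined by choice, takes this value.\<close>
  moreover have "at r within {0..} \<noteq> bot"
    using at_le[of "{r<..}" "{0..}" r] \<open>0 \<le> r\<close> trivial_limit_at_right_real[of r]
    by (force simp: trivial_limit_def bot_unique)
  ultimately show ?thesis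
    unfolding density_deriv_def
    by (simp add: has_real_derivative_iff_has_vector_derivative vector_derivative_within)
qed

theorem theorem2p3:
  fixes \<rho> v f :: "real \<Rightarrow> real" and \<gamma> v_max :: real
    and n :: nat and x :: "nat \<Rightarrow> real \<Rightarrow> real"
  defines "R \<equiv> ftl_density n x"
  assumes "integrable lebesgue \<rho>"
    and "\<exists>C. AE y in lebesgue. \<bar>\<rho> y\<bar> \<le> C"
    and "AE y in lebesgue. 0 \<le> \<rho> y"
    and "compact (ess_support \<rho>)"
    and "(LINT y|lebesgue. \<bar>\<rho> y\<bar>) = 1"
    and "\<gamma> > 0"
    and "\<And>r. r \<ge> 0 \<Longrightarrow> v r = v_max - r powr \<gamma>"
    and "\<And>r. r \<ge> 0 \<Longrightarrow> f r = r * v r"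
    and "n \<ge> 1"
    and "ftl_particles \<rho> v n x"
  shows "\<forall>t\<ge>0. \<forall>i<n.
      t * ((v (R (Suc i) t) - v (R i t)) / (x (Suc i) t - x i t)) \<le> 1 / (\<gamma> + 1) \<and>
      t * ((density_deriv f (R (Suc i) t) - density_deriv f (R i t)) / (x (Suc i) t - x i t)) \<le> 1"
proof -
  \<comment> \<open>Unlike the quotient of differences, this form needs no particle beyond the
    leader; it vanishes for \<open>i = n\<close>, which starts the induction.\<close>
  define u where "u i t = n * R i t * (R i t powr \<gamma> - R (Suc i) t powr \<gamma>)" for i t
  have R_n: "R n t = 0" for t by (simp add: R_def ftl_density_def)
  have ord: "x i t < x (Suc i) t" if "0 \<le> t" "i < n" for i t
    using assms(11) that unfolding ftl_particles_def by blast
  have R_eq: "R i t = 1 / (n * (x (Suc i) t - x i t))" if "i < n" for i t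
    using that by (simp add: R_def ftl_density_def)
  have R_pos: "0 < R i t" if "0 \<le> t" "i < n" for i t
    using ord[OF that] that by (simp add: R_eq)
  have R_nonneg: "0 \<le> R i t" if "0 \<le> t" for i t
  proof (cases "i < n")
    case True
    with R_pos[OF that] show ?thesis by (simp add: less_imp_le)
  qed (simp add: R_def ftl_density_def)
  have v_R: "v (R i t) = v_max - R i t powr \<gamma>" if "0 \<le> t" for i t
    using assms(8)[OF R_nonneg[OF that]] .
  \<comment> \<open>Since \<open>R n t = 0\<close>, the leader with its speed \<open>v 0\<close>
    obeys the same equation as the followers.\<close>
  have dx: "(x i has_real_derivative v (R i t)) (at t within {0..})" if "0 \<le> t" "i \<le> n" for i t
    using assms(11) that R_n unfolding ftl_particles_def R_def
    by (cases "i = n") auto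
  have slope: "(v (R (Suc i) t) - v (R i t)) / (x (Suc i) t - x i t) = u i t"
    if "0 \<le> t" "i < n" for i t
  proof -
    have "n * R i t = 1 / (x (Suc i) t - x i t)"
      using that by (simp add: R_eq)
    then show ?thesis
      using that by (simp add: u_def v_R)
  qed
  have dR: "(R i has_real_derivative - R i t * u i t) (at t within {0..})"
    if "0 \<le> t" "i < n" for i t
  proof -
    have "((\<lambda>t. x (Suc i) t - x i t) has_real_derivative v (R (Suc i) t) - v (R i t))
        (at t within {0..})"
      using that by (intro DERIV_diff dx) auto
    from DERIV_divide[OF DERIV_const this, of "1 / n"]
    have "((\<lambda>t. (1 / n) / (x (Suc i) t - x i t)) has_real_derivative
        - R i t * u i t) (at t within {0..})"
      unfolding slope[OF that, symmetric]
      using ord[OF that] that by (simp add: R_eq[of i] mult.assoc)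
    moreover have "(\<lambda>t. (1 / n) / (x (Suc i) t - x i t)) = R i"
      using that by (simp add: R_def ftl_density_def fun_eq_iff)
    ultimately show ?thesis by simp
  qed
  have dpowr: "((\<lambda>t. R i t powr \<gamma>) has_real_derivative - \<gamma> * R i t powr \<gamma> * u i t) (at t within {0..})"
    if "0 \<le> t" "i \<le> n" for i t
  proof (cases "i = n")
    case True
    then show ?thesis by (simp add: R_n)
  next
    case False
    with that have "i < n" by simp
    with \<open>0 \<le> t\<close> show ?thesis
      by (intro DERIV_powr_relative_rate dR R_pos)
  qed
  have bound: "\<forall>t\<ge>0. t * u i t \<le> 1 / (\<gamma> + 1)" if "i \<le> n" for i
    using that
  proof (induction rule: inc_induct)
    case base
    show ?case using \<open>\<gamma> > 0\<close> by (simp add: u_def R_n)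
  next
    case (step i)
    show ?case
      unfolding u_def
      \<comment> \<open>The roles are \<open>a = R i\<close>,
        \<open>q = R (Suc i) powr \<gamma>\<close> and \<open>K = n\<close>; the induction
        hypothesis supplies the bound on \<open>s\<close>.\<close>
      by (intro allI impI slope_bound_step[where s = "u (Suc i)"])
        (use step \<open>\<gamma> > 0\<close> R_pos dR[of _ i] dpowr[of _ "Suc i"] in \<open>auto simp: u_def\<close>)
  qed
  have f_eq: "f r = r * (v_max - r powr \<gamma>)" if "0 \<le> r" for r
    using assms(8,9) that by simp
  show ?thesis
  proof (intro allI impI conjI)
    fix t :: real and i :: nat
    assume t: "0 \<le> t" and i: "i < n"
    show v_bound: "t * ((v (R (Suc i) t) - v (R i t)) / (x (Suc i) t - x i t)) \<le> 1 / (\<gamma> + 1)"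
      using bound[of i] slope[OF t i] t i by simp
    have f': "density_deriv f (R j t) = v_max - (\<gamma> + 1) * R j t powr \<gamma>" for j
      using density_deriv_power_flux[OF \<open>\<gamma> > 0\<close> R_nonneg[OF t] f_eq] .
    \<comment> \<open>On nonnegative densities \<open>f'\<close> equals
      \<open>(\<gamma> + 1) * v - \<gamma> * v_max\<close>, so the second estimate is the first one
      scaled by \<open>\<gamma> + 1\<close>.\<close>
    have "density_deriv f (R (Suc i) t) - density_deriv f (R i t)
        = (\<gamma> + 1) * (v (R (Suc i) t) - v (R i t))"
      by (simp add: f' v_R[OF t] algebra_simps)
    then show "t * ((density_deriv f (R (Suc i) t) - density_deriv f (R i t))
        / (x (Suc i) t - x i t)) \<le> 1"
      using v_bound \<open>\<gamma> > 0\<close> by (simp add: pos_le_divide_eq mult.commute mult.left_commute)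
  qed
qed

end
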